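(* Every set $P$ of $n\ge 1$ points in $\mathbb{R}^2$ admits a Euclidean spanner (without Steiner points) with at most $2n-2$ edges and stretch $4\sqrt{26}$, and a Steiner spanner with at most $4n-4$ edges and stretch $\sqrt{26}$.
   Context: A $t$-spanner (spanner with stretch $t$) of a finite set $P\subset\mathbb{R}^2$ is a graph $G$ with vertex set $P$, each edge weighted by the Euclidean distance between its endpoints, such that $d_G(x,y)\le t\cdot\|x-y\|$ for all $x,y\in P$, where $d_G$ is the weighted shortest-path distance. A Steiner $t$-spanner of $P$ is an edge-weighted graph $G$ with $P\subseteq V(G)$, possibly having additional vertices (Steiner points), such that $\|x-y\|\le d_G(x,y)\le t\cdot\|x-y\|$ for all $x,y\in P$. *)

theory Defs
  imports "HOL-Analysis.Analysis" "Graph_Theory.Graph_Theory"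
begin

text \<open>
  A finite simple undirected graph is a \<^locale>\<open>pair_graph\<close>, i.e. a finite loop-free digraph
  without parallel arcs whose arc relation is symmetric. Each undirected edge occurs there as two
  opposite arcs, so edges are counted as unordered pairs and edge weights have to be symmetric.
\<close>

type_synonym plane_graph = "(real^2) pair_pre_digraph"

definition undirected_edges :: "'a pair_pre_digraph \<Rightarrow> 'a set set" where
  "undirected_edges G = {{u, v} |u v. (u, v) \<in> parcs G}"

definition edge_weighting :: "'a pair_pre_digraph \<Rightarrow> ('a \<times> 'a) weight_fun \<Rightarrow> bool" where
  "edge_weighting G w \<longleftrightarrow> (\<forall>(u, v) \<in> parcs G. w (u, v) = w (v, u) \<and> w (u, v) > 0)"

text \<open>The value is \<open>\<infinity>\<close> if no walk connects the two vertices.\<close>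

definition graph_distance ::
    "'a pair_pre_digraph \<Rightarrow> ('a \<times> 'a) weight_fun \<Rightarrow> 'a \<Rightarrow> 'a \<Rightarrow> ereal" where
  "graph_distance G w x y = wf_digraph.\<mu> (with_proj G) w x y"

definition euclidean_weight :: "((real^2) \<times> (real^2)) weight_fun" where
  "euclidean_weight = (\<lambda>(u, v). norm (u - v))"

definition euclidean_spanner :: "real \<Rightarrow> (real^2) set \<Rightarrow> plane_graph \<Rightarrow> bool" where
  "euclidean_spanner t P G \<longleftrightarrow>
     pair_graph G \<and> pverts G = P \<and>
     (\<forall>x\<in>P. \<forall>y\<in>P. graph_distance G euclidean_weight x y \<le> ereal (t * norm (x - y)))"

text \<open>
  The weights of a Steiner spanner are unrelated to the Euclidean distance between the end points,
  so the position of a Steiner vertex carries no information: the points of the plane outside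
  \<open>P\<close> only serve as an infinite supply of names for additional vertices.
\<close>

definition steiner_spanner ::
    "real \<Rightarrow> (real^2) set \<Rightarrow> plane_graph \<Rightarrow> ((real^2) \<times> (real^2)) weight_fun \<Rightarrow> bool" where
  "steiner_spanner t P G w \<longleftrightarrow>
     pair_graph G \<and> P \<subseteq> pverts G \<and> edge_weighting G w \<and>
     (\<forall>x\<in>P. \<forall>y\<in>P. ereal (norm (x - y)) \<le> graph_distance G w x y \<and>
        graph_distance G w x y \<le> ereal (t * norm (x - y)))"

end

theory Submission
  imports Defs
begin

text \<open>
  Consider two quadtrees whose grids are turned by 45 degrees against each other such that every
  triangle of the Sierpinski subdivision of a right isosceles triangle has its hypotenuse on a
  diagonal of a cell of one quadtree and its legs on diagonals of cells of the other. The diagonals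
  of the cells of one quadtree form a tree. Two points are separated at some step by the
  altitude of such a triangle; they lie on opposite sides of a branch of the tree that contains this
  altitude, and walking in this tree through the altitude costs at most
  \<open>5 * \<bar>dx\<bar> + \<bar>dy\<bar> \<le> sqrt 26 * norm (dx, dy)\<close>. Suppressing useless branching points gives Steiner
  trees with at most \<open>2 * n - 2\<close> edges. Replacing each branching point by the closest representative of
  its subtrees gives trees on the \<open>n\<close> points themselves and costs a factor 4.
\<close>

section \<open>Geometry of the diagonal trees\<close>

text \<open>
  A cell is a square with a distinguished diagonal, its base, normalised to run from \<open>(0, 0)\<close> to
  \<open>(1, 0)\<close>. The base of each of its quadrants has one end at the centre \<open>(1/2, 0)\<close>: this is the end
  \<open>(1, 0)\<close> for \<open>Near\<close> and the end \<open>(0, 0)\<close> for the other three.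
\<close>

definition diamond :: "(real \<times> real) set" where
  "diamond = {(x, y). \<bar>y\<bar> \<le> x \<and> \<bar>y\<bar> \<le> 1 - x}"

datatype quadrant = Near | Far | Up | Down

definition quadrant :: "real \<times> real \<Rightarrow> quadrant" where
  "quadrant z = (if \<bar>snd z\<bar> \<le> \<bar>fst z - 1/2\<bar> then (if fst z \<le> 1/2 then Near else Far)
     else if snd z > 0 then Up else Down)"

fun zoom :: "quadrant \<Rightarrow> real \<times> real \<Rightarrow> real \<times> real" where
  "zoom Near (x, y) = (2 * x, 2 * y)"
| "zoom Far (x, y) = (2 * x - 1, 2 * y)"
| "zoom Up (x, y) = (2 * y, 1 - 2 * x)"
| "zoom Down (x, y) = (- 2 * y, 2 * x - 1)"

abbreviation zoomq :: "real \<times> real \<Rightarrow> real \<times> real" where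
  "zoomq z \<equiv> zoom (quadrant z) z"

text \<open>
  Distances to the two ends of the base in the tree formed by the bases of all cells down to depth \<open>n\<close>,
  to which a point is attached by the perpendicular onto the base of its smallest cell.
\<close>

fun near_dist :: "nat \<Rightarrow> real \<times> real \<Rightarrow> real" and far_dist :: "nat \<Rightarrow> real \<times> real \<Rightarrow> real" where
  "near_dist 0 z = fst z + \<bar>snd z\<bar>"
| "far_dist 0 z = 1 - fst z + \<bar>snd z\<bar>"
| "near_dist (Suc n) z = near_dist n (zoomq z) / 2 + (if quadrant z = Near then 0 else 1/2)"
| "far_dist (Suc n) z = (if quadrant z = Near then 1/2 + far_dist n (zoomq z) / 2
     else if quadrant z = Far then far_dist n (zoomq z) / 2 else 1/2 + near_dist n (zoomq z) / 2)"

definition centre_dist :: "nat \<Rightarrow> real \<times> real \<Rightarrow> real" where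
  "centre_dist n z = (if quadrant z = Near then far_dist n (zoomq z) else near_dist n (zoomq z)) / 2"

text \<open>The value at depth 0 is irrelevant, since distinct points will not share a cell of that depth.\<close>

fun tree_dist :: "nat \<Rightarrow> real \<times> real \<Rightarrow> real \<times> real \<Rightarrow> real" where
  "tree_dist 0 z w = 0"
| "tree_dist (Suc n) z w = (if quadrant z = quadrant w then tree_dist n (zoomq z) (zoomq w) / 2
     else centre_dist n z + centre_dist n w)"

lemma quadrant_iff:
  "quadrant (x, y) = Near \<longleftrightarrow> \<bar>y\<bar> \<le> 1/2 - x"
  "quadrant (x, y) = Far \<longleftrightarrow> \<bar>y\<bar> \<le> x - 1/2 \<and> 1/2 < x"
  "quadrant (x, y) = Up \<longleftrightarrow> \<bar>x - 1/2\<bar> < y"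
  "quadrant (x, y) = Down \<longleftrightarrow> \<bar>x - 1/2\<bar> < - y"
  by (auto simp: quadrant_def)

lemma zoom_diamond:
  assumes "z \<in> diamond"
  shows "zoomq z \<in> diamond"
  using assms by (cases z) (auto simp: diamond_def quadrant_def abs_if split: if_splits)

text \<open>The third bound is the second one seen from the \<open>Up\<close> and \<open>Down\<close> quadrants of the parent cell.\<close>

lemma near_far_dist_bounds:
  assumes "(x, y) \<in> diamond"
  shows "near_dist n (x, y) \<le> x + 5 * \<bar>y\<bar> \<and> near_dist n (x, y) \<le> 5 * x - \<bar>y\<bar> \<and>
         near_dist n (x, y) \<le> 4 - x - 5 * \<bar>y\<bar> \<and>
         far_dist n (x, y) \<le> 1 - x + 5 * \<bar>y\<bar> \<and> far_dist n (x, y) \<le> 5 * (1 - x) - \<bar>y\<bar>"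
  using assms
proof (induction n arbitrary: x y)
  case 0
  then show ?case by (auto simp: diamond_def abs_if split: if_splits)
next
  case (Suc n)
  have z: "zoomq (x, y) \<in> diamond"
    using zoom_diamond Suc.prems by blast
  have s: "\<bar>y\<bar> \<le> x" "\<bar>y\<bar> \<le> 1 - x"
    using Suc.prems by (auto simp: diamond_def)
  consider (n) "quadrant (x, y) = Near" "\<bar>y\<bar> \<le> 1/2 - x"
    | (f) "quadrant (x, y) = Far" "\<bar>y\<bar> \<le> x - 1/2"
    | (u) "quadrant (x, y) = Up" "\<bar>x - 1/2\<bar> < y"
    | (d) "quadrant (x, y) = Down" "\<bar>x - 1/2\<bar> < - y"
    using quadrant_iff[of x y] quadrant.exhaust[of "quadrant (x, y)"] by metis
  then show ?case
  proof cases
    case n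
    show ?thesis using Suc.IH[of "2*x" "2*y"] z n s by auto
  next
    case f
    show ?thesis using Suc.IH[of "2*x-1" "2*y"] z f s by auto
  next
    case u
    show ?thesis using Suc.IH[of "2*y" "1-2*x"] z u s by (auto simp: abs_if split: if_splits)
  next
    case d
    show ?thesis using Suc.IH[of "-2*y" "2*x-1"] z d s by (auto simp: abs_if split: if_splits)
  qed
qed

text \<open>The centre is an end of the quadrant's base, so these are the bounds of
  \<open>near_far_dist_bounds\<close> after halving. The bases of \<open>Up\<close> and
  \<open>Down\<close> are perpendicular to that of the cell, hence the coordinates trade
  places.\<close>

lemma centre_dist_bounds:
  assumes "(x, y) \<in> diamond"
  shows "quadrant (x, y) \<in> {Near, Far} \<Longrightarrow> centre_dist n (x, y) \<le> \<bar>x - 1/2\<bar> + 5 * \<bar>y\<bar>"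
    and "quadrant (x, y) \<in> {Near, Far} \<Longrightarrow> centre_dist n (x, y) \<le> 5 * \<bar>x - 1/2\<bar> - \<bar>y\<bar>"
    and "quadrant (x, y) \<in> {Up, Down} \<Longrightarrow> centre_dist n (x, y) \<le> \<bar>y\<bar> + 5 * \<bar>x - 1/2\<bar>"
    and "quadrant (x, y) \<in> {Up, Down} \<Longrightarrow> centre_dist n (x, y) \<le> 5 * \<bar>y\<bar> - \<bar>x - 1/2\<bar>"
  using near_far_dist_bounds[of "fst (zoomq (x, y))" "snd (zoomq (x, y))" n] zoom_diamond[OF assms] assms
  by (auto simp: centre_dist_def quadrant_def diamond_def abs_if split: if_splits)

text \<open>Points on opposite sides of the base can share only \<open>Near\<close> or
  \<open>Far\<close>, whose bases are halves of this base, so induction applies. In all other cases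
  their paths meet at the centre.\<close>

lemma tree_dist_across_base:
  assumes "(x, y) \<in> diamond" "(x', y') \<in> diamond" "y \<ge> 0" "y' \<le> 0"
  shows "tree_dist n (x, y) (x', y') \<le> \<bar>x - x'\<bar> + 5 * (y - y')"
    and "tree_dist n (x', y') (x, y) \<le> \<bar>x - x'\<bar> + 5 * (y - y')"
proof -
  have "tree_dist n (x, y) (x', y') \<le> \<bar>x - x'\<bar> + 5 * (y - y') \<and>
    tree_dist n (x', y') (x, y) \<le> \<bar>x - x'\<bar> + 5 * (y - y')"
    using assms
  proof (induction n arbitrary: x y x' y')
    case 0
    then show ?case by auto
  next
    case (Suc n)
    have z: "zoomq (x, y) \<in> diamond" "zoomq (x', y') \<in> diamond"
      using zoom_diamond Suc.prems by blast+
    have nd: "quadrant (x, y) \<noteq> Down" "quadrant (x', y') \<noteq> Up"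
      using Suc.prems by (auto simp: quadrant_def)
    show ?case
    proof (cases "quadrant (x, y) = quadrant (x', y')")
      case True
      then have "quadrant (x, y) = Near \<or> quadrant (x, y) = Far"
        using nd by (cases "quadrant (x, y)") auto
      then show ?thesis
        using Suc.IH[of "2*x" "2*y" "2*x'" "2*y'"] Suc.IH[of "2*x-1" "2*y" "2*x'-1" "2*y'"]
          True z Suc.prems by (auto simp: abs_if split: if_splits)
    next
      case False
      \<comment> \<open>For \<open>Up\<close> and \<open>Down\<close> the horizontal term of the
        bound is negative, and the triangle inequality absorbs it into
        \<open>\<bar>x - x'\<bar>\<close>.\<close>
      note b = centre_dist_bounds[OF Suc.prems(1), of n] centre_dist_bounds[OF Suc.prems(2), of n]
      have q: "quadrant (x, y) = Near \<Longrightarrow> x \<le> 1/2" "quadrant (x, y) = Far \<Longrightarrow> x \<ge> 1/2"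
        "quadrant (x', y') = Near \<Longrightarrow> x' \<le> 1/2" "quadrant (x', y') = Far \<Longrightarrow> x' \<ge> 1/2"
        by (auto simp: quadrant_def split: if_splits)
      show ?thesis
        using False b q nd Suc.prems(3,4)
        by (cases "quadrant (x, y)"; cases "quadrant (x', y')")
          (auto simp: abs_if split: if_splits)
    qed
  qed
  then show "tree_dist n (x, y) (x', y') \<le> \<bar>x - x'\<bar> + 5 * (y - y')"
    "tree_dist n (x', y') (x, y) \<le> \<bar>x - x'\<bar> + 5 * (y - y')" by auto
qed

lemma tree_dist_sym: "tree_dist n z w = tree_dist n w z"
  by (induction n arbitrary: z w) auto

text \<open>The altitude from the centre is the base of \<open>Up\<close> or \<open>Down\<close>.
  Inside that quadrant \<open>tree_dist_across_base\<close> applies in turned coordinates, which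
  exchanges the factors 1 and 5; points of different quadrants meet at the centre.\<close>

lemma tree_dist_across_spike:
  assumes "(x, y) \<in> diamond" "(x', y') \<in> diamond" "(y \<ge> 0 \<and> y' \<ge> 0) \<or> (y \<le> 0 \<and> y' \<le> 0)"
    and "x \<le> 1/2" "1/2 \<le> x'"
  shows "tree_dist n (x, y) (x', y') \<le> 5 * (x' - x) + \<bar>y - y'\<bar>"
proof (cases n)
  case 0
  then show ?thesis using assms by auto
next
  case (Suc m)
  have z: "zoomq (x, y) \<in> diamond" "zoomq (x', y') \<in> diamond"
    using zoom_diamond assms by blast+
  show ?thesis
  proof (cases "quadrant (x, y) = quadrant (x', y')")
    case True
    consider "quadrant (x, y) = Near" | "quadrant (x, y) = Up" | "quadrant (x, y) = Down"
      using assms(4) quadrant_iff(2)[of x y] by (cases "quadrant (x, y)") auto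
    then show ?thesis
    proof cases
      \<comment> \<open>The centre counts as \<open>Near\<close>, so the right-hand point can only
        be the centre. It is an end of the base of \<open>Near\<close> and thus lies on both sides
        of that base.\<close>
      case 1
      then have e: "x' = 1/2" "y' = 0" "\<bar>y\<bar> \<le> 1/2 - x"
        using True assms(5) quadrant_iff(1)[of x y] quadrant_iff(1)[of x' y'] by auto
      have d: "(2 * x, 2 * y) \<in> diamond" "(1, 0) \<in> diamond"
        using z(1) 1 by (auto simp: diamond_def)
      have "tree_dist m (2 * x, 2 * y) (1, 0) \<le> \<bar>2 * x - 1\<bar> + 5 * \<bar>2 * y\<bar>"
        using tree_dist_across_base(1)[OF d] tree_dist_across_base(2)[OF d(2,1)]
        by (cases "y \<ge> 0") (auto simp: abs_minus_commute)
      then show ?thesis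
        using 1 True e(3) Suc unfolding e(1,2) by simp
    next
      case 2
      then show ?thesis
        using tree_dist_across_base(1)[of "2*y" "1-2*x" "2*y'" "1-2*x'" m] True z Suc assms
        by (auto simp: abs_if split: if_splits)
    next
      case 3
      then show ?thesis
        using tree_dist_across_base(2)[of "-2*y'" "2*x'-1" "-2*y" "2*x-1" m] True z Suc assms
        by (auto simp: abs_if split: if_splits)
    qed
  next
    case False
    note b = centre_dist_bounds[OF assms(1), of m] centre_dist_bounds[OF assms(2), of m]
    show ?thesis
      using False b quadrant_iff[of x y] quadrant_iff[of x' y'] assms(3-5) Suc
      by (cases "quadrant (x, y)"; cases "quadrant (x', y')") auto
  qed
qed

text \<open>The l1 norm: \<open>diamond\<close> is a ball of diameter 1 for it, and zooming doubles
  it because quadrants are turned by multiples of 90 degrees.\<close>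

definition taxi :: "real \<times> real \<Rightarrow> real" where
  "taxi z = \<bar>fst z\<bar> + \<bar>snd z\<bar>"

lemma taxi_zoom:
  assumes "quadrant z = quadrant w"
  shows "taxi (zoomq z - zoomq w) = 2 * taxi (z - w)"
  using assms by (cases z; cases w; cases "quadrant w") (auto simp: taxi_def abs_if)

lemma norm_zoom:
  assumes "quadrant z = quadrant w"
  shows "norm (zoomq z - zoomq w) = 2 * norm (z - w)"
proof -
  obtain x y x' y' where e: "z = (x, y)" "w = (x', y')" by (metis surj_pair)
  have "sqrt (4 * c) = 2 * sqrt c" for c
    by (simp add: real_sqrt_mult)
  from this[of "(x - x')\<^sup>2 + (y - y')\<^sup>2"] show ?thesis
    using assms unfolding e
    by (cases "quadrant (x', y')") (simp_all add: norm_Pair power2_eq_square algebra_simps)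
qed

text \<open>Cauchy-Schwarz with the vector (5, 1); the squares differ by exactly
  \<open>(\<bar>a\<bar> - 5 * \<bar>b\<bar>)^2\<close>.\<close>

lemma five_one_le_sqrt26: "5 * \<bar>a\<bar> + \<bar>b\<bar> \<le> sqrt 26 * norm (a::real, b::real)"
proof -
  have "(5 * \<bar>a\<bar> + \<bar>b\<bar>)\<^sup>2 \<le> 26 * (a\<^sup>2 + b\<^sup>2)"
    using zero_le_power2[of "\<bar>a\<bar> - 5 * \<bar>b\<bar>"] by (simp add: power2_eq_square algebra_simps)
  then show ?thesis
    by (simp add: norm_Pair real_le_rsqrt flip: real_sqrt_mult)
qed

section \<open>Two coupled quadtrees\<close>

text \<open>
  \<open>l\<close> and \<open>h\<close> are the coordinates of one point in a cell of either tree. The point lies in a triangle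
  with a leg along half of the first base, in the right (\<open>r\<close>) or left half and below (\<open>d\<close>) or above it,
  and with the second base as hypotenuse, which runs away from (\<open>\<not> i\<close>) or towards (\<open>i\<close>) the end of the
  first base and has the triangle above (\<open>\<not> j\<close>) or below (\<open>j\<close>) it.
\<close>

definition coupled :: "bool \<Rightarrow> bool \<Rightarrow> bool \<Rightarrow> bool \<Rightarrow> real \<times> real \<Rightarrow> real \<times> real \<Rightarrow> bool" where
  "coupled r d i j l h \<longleftrightarrow>
     (let u = (if r then 1 - fst l else fst l); v = (if d then - snd l else snd l)
      in 0 \<le> v \<and> v \<le> u \<and> u \<le> 1/2 \<and>
         h = (if i then 1 - (u + v) else u + v, if j then v - u else u - v))"

lemma coupled_diamond:
  assumes "coupled r d i j l h"
  shows "l \<in> diamond" "h \<in> diamond"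
  using assms by (cases l, auto simp: coupled_def diamond_def Let_def split: if_splits)+

text \<open>
  Each half of the triangle is coupled again after the two trees have exchanged their roles.
\<close>

lemma coupled_step:
  assumes "coupled r d i j l h"
  shows "fst h < 1/2 \<Longrightarrow> quadrant l = (if i then if d then Down else Up else if r then Far else Near) \<and>
           coupled False j (i \<or> r) (if i then r \<noteq> d else d) h (zoomq l)"
    and "fst h > 1/2 \<Longrightarrow> quadrant l = (if i then if r then Far else Near else if d then Down else Up) \<and>
           coupled True j (\<not> i \<or> r) (if i then d else r \<noteq> d) h (zoomq l)"
proof -
  obtain x y where l: "l = (x, y)" by force
  show "fst h < 1/2 \<Longrightarrow> quadrant l = (if i then if d then Down else Up else if r then Far else Near) \<and>
           coupled False j (i \<or> r) (if i then r \<noteq> d else d) h (zoomq l)"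
    using assms quadrant_iff[of x y] unfolding l
    by (cases r; cases d; cases i; cases j) (auto simp: coupled_def Let_def abs_if split: if_splits)
  show "fst h > 1/2 \<Longrightarrow> quadrant l = (if i then if r then Far else Near else if d then Down else Up) \<and>
           coupled True j (\<not> i \<or> r) (if i then d else r \<noteq> d) h (zoomq l)"
    using assms quadrant_iff[of x y] unfolding l
    by (cases r; cases d; cases i; cases j) (auto simp: coupled_def Let_def abs_if split: if_splits)
qed

text \<open>Either the altitude onto the hypotenuse, where \<open>fst h = 1/2\<close>, separates the
  points and the second tree serves them, or both lie in one half, and the trees swap roles with the
  first one a level deeper. Each disjunct is homogeneous, so the two scales need not agree. At depth
  0 the claim is trivial because \<open>tree_dist\<close> is 0 there.\<close>

lemma coupled_stretch:
  assumes "coupled r d i j l h" "coupled r d i j l' h'"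
  shows "tree_dist n l l' \<le> sqrt 26 * norm (l - l') \<or> tree_dist m h h' \<le> sqrt 26 * norm (h - h')"
  using assms
proof (induction "n + m" arbitrary: n m r d i j l h l' h')
  case 0
  then show ?case by simp
next
  case (Suc k)
  obtain x y x' y' where h: "h = (x, y)" "h' = (x', y')" by (metis surj_pair)
  have dia: "(x, y) \<in> diamond" "(x', y') \<in> diamond"
    using coupled_diamond Suc.prems h by blast+
  have side: "(y \<ge> 0 \<and> y' \<ge> 0) \<or> (y \<le> 0 \<and> y' \<le> 0)"
    using Suc.prems h by (auto simp: coupled_def Let_def split: if_splits)
  show ?case
  proof (cases n)
    case 0
    then show ?thesis by simp
  next
    case n: (Suc n')
    consider "x \<le> 1/2" "1/2 \<le> x'" | "x' \<le> 1/2" "1/2 \<le> x" | "x < 1/2" "x' < 1/2" | "x > 1/2" "x' > 1/2"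
      by linarith
    then show ?thesis
    proof cases
      case 1
      then have "tree_dist m h h' \<le> 5 * \<bar>x - x'\<bar> + \<bar>y - y'\<bar>"
        using tree_dist_across_spike[OF dia side 1] h by simp
      then show ?thesis using five_one_le_sqrt26[of "x - x'" "y - y'"] h by force
    next
      case 2
      have "(y' \<ge> 0 \<and> y \<ge> 0) \<or> (y' \<le> 0 \<and> y \<le> 0)" using side by auto
      then have "tree_dist m h h' \<le> 5 * \<bar>x - x'\<bar> + \<bar>y - y'\<bar>"
        using tree_dist_across_spike[OF dia(2,1) _ 2, of m] h tree_dist_sym[of m h h'] 2 by simp
      then show ?thesis using five_one_le_sqrt26[of "x - x'" "y - y'"] h by force
    next
      case 3
      then have q: "quadrant l = quadrant l'" and
        c: "coupled False j (i \<or> r) (if i then r \<noteq> d else d) h (zoomq l)"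
           "coupled False j (i \<or> r) (if i then r \<noteq> d else d) h' (zoomq l')"
        using coupled_step(1)[OF Suc.prems(1)] coupled_step(1)[OF Suc.prems(2)] h by auto
      \<comment> \<open>The induction hypothesis is used with the trees exchanged; zooming halves
        \<open>tree_dist\<close> and doubles the norm.\<close>
      show ?thesis
        using Suc.hyps(1)[OF _ c, of m n'] Suc.hyps(2) norm_zoom[OF q] n q by auto
    next
      case 4
      then have q: "quadrant l = quadrant l'" and
        c: "coupled True j (\<not> i \<or> r) (if i then d else r \<noteq> d) h (zoomq l)"
           "coupled True j (\<not> i \<or> r) (if i then d else r \<noteq> d) h' (zoomq l')"
        using coupled_step(2)[OF Suc.prems(1)] coupled_step(2)[OF Suc.prems(2)] h by auto
      show ?thesis
        using Suc.hyps(1)[OF _ c, of m n'] Suc.hyps(2) norm_zoom[OF q] n q by auto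
    qed
  qed
qed

section \<open>Trees with Steiner points\<close>

text \<open>\<open>r\<close> is only an upper bound for the length, so slack may enter at every
  step. Pairs in \<open>E\<close> are read as undirected edges.\<close>

inductive walk_le :: "('a::metric_space \<times> 'a) set \<Rightarrow> 'a \<Rightarrow> 'a \<Rightarrow> real \<Rightarrow> bool" for E where
  walk_le_refl: "0 \<le> r \<Longrightarrow> walk_le E x x r"
| walk_le_step: "(x, y) \<in> E \<or> (y, x) \<in> E \<Longrightarrow> walk_le E y z r \<Longrightarrow> dist x y + r \<le> s \<Longrightarrow> walk_le E x z s"

lemma walk_le_mono:
  assumes "walk_le E x y r" "E \<subseteq> F" "r \<le> s"
  shows "walk_le F x y s"
  using assms
proof (induction arbitrary: s)
  case (walk_le_refl r x)
  then show ?case by (auto intro: walk_le.walk_le_refl)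
next
  case (walk_le_step x y z r t)
  then show ?case by (intro walk_le.walk_le_step[of x y _ z r]) auto
qed

lemma walk_le_edge:
  assumes "(x, y) \<in> E \<or> (y, x) \<in> E" "dist x y \<le> r"
  shows "walk_le E x y r"
  using walk_le_step[OF assms(1) walk_le_refl[of 0]] assms(2) by auto

lemma walk_le_trans:
  assumes "walk_le E x y r" "walk_le E y z s" "r + s \<le> t"
  shows "walk_le E x z t"
  using assms
proof (induction arbitrary: t)
  case (walk_le_refl r x)
  then show ?case using walk_le_mono by fastforce
next
  case (walk_le_step x y w r u)
  then show ?case by (intro walk_le.walk_le_step[of x y _ z "r + s"]) auto
qed

lemma walk_le_sym: "walk_le E x y r \<Longrightarrow> walk_le E y x r"
proof (induction rule: walk_le.induct)
  case (walk_le_refl r x)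
  then show ?case by (auto intro: walk_le.walk_le_refl)
next
  case (walk_le_step x y z r s)
  have "walk_le E y x (dist x y)"
    using walk_le_step(1) by (intro walk_le_edge) (auto simp: dist_commute)
  then show ?case using walk_le_trans walk_le_step by (metis add.commute)
qed

text \<open>
  A tree for \<open>Q\<close> with root \<open>r\<close> that could be hung at \<open>c\<close> by one further edge, which is not counted.
  This delay avoids branching points of degree 2.
\<close>

definition hang :: "'a::metric_space set \<Rightarrow> 'a \<Rightarrow> ('a \<Rightarrow> real) \<Rightarrow> ('a \<Rightarrow> 'a \<Rightarrow> real) \<Rightarrow> bool" where
  "hang Q c \<delta> \<gamma> \<longleftrightarrow> Q = {} \<or>
     (\<exists>E r. finite E \<and> card E \<le> 2 * card Q - 2 \<and> (\<forall>p\<in>Q. walk_le E p r (\<delta> p - dist r c)) \<and>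
        (\<forall>p\<in>Q. \<forall>q\<in>Q. p \<noteq> q \<longrightarrow> walk_le E p q (\<gamma> p q)))"

lemma hangE:
  assumes "hang Q c \<delta> \<gamma>" "Q \<noteq> {}"
  obtains E r where "finite E" "card E \<le> 2 * card Q - 2"
    "\<And>p. p \<in> Q \<Longrightarrow> walk_le E p r (\<delta> p - dist r c)"
    "\<And>p q. p \<in> Q \<Longrightarrow> q \<in> Q \<Longrightarrow> p \<noteq> q \<Longrightarrow> walk_le E p q (\<gamma> p q)"
proof -
  have "\<exists>E r. finite E \<and> card E \<le> 2 * card Q - 2 \<and>
    (\<forall>p\<in>Q. walk_le E p r (\<delta> p - dist r c)) \<and>
    (\<forall>p\<in>Q. \<forall>q\<in>Q. p \<noteq> q \<longrightarrow> walk_le E p q (\<gamma> p q))"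
    using assms unfolding hang_def by simp
  then obtain E r where "finite E \<and> card E \<le> 2 * card Q - 2 \<and>
    (\<forall>p\<in>Q. walk_le E p r (\<delta> p - dist r c)) \<and>
    (\<forall>p\<in>Q. \<forall>q\<in>Q. p \<noteq> q \<longrightarrow> walk_le E p q (\<gamma> p q))"
    by (elim exE)
  then show thesis
    by (intro that[of E r]) simp_all
qed

lemma hang_empty: "hang {} c \<delta> \<gamma>"
  by (simp add: hang_def)

lemma hangI:
  assumes "finite E" "card E \<le> 2 * card Q - 2"
    "\<And>p. p \<in> Q \<Longrightarrow> walk_le E p r (\<delta> p - dist r c)"
    "\<And>p q. p \<in> Q \<Longrightarrow> q \<in> Q \<Longrightarrow> p \<noteq> q \<Longrightarrow> walk_le E p q (\<gamma> p q)"
  shows "hang Q c \<delta> \<gamma>"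
  unfolding hang_def by (intro disjI2 exI[of _ E] exI[of _ r]) (use assms in simp)

lemma hang_mono:
  assumes "hang Q c \<delta> \<gamma>" "\<And>p. p \<in> Q \<Longrightarrow> \<delta> p \<le> \<delta>' p"
    and "\<And>p q. p \<in> Q \<Longrightarrow> q \<in> Q \<Longrightarrow> p \<noteq> q \<Longrightarrow> \<gamma> p q \<le> \<gamma>' p q"
  shows "hang Q c \<delta>' \<gamma>'"
proof (cases "Q = {}")
  case False
  with assms(1) obtain E r where E: "finite E" "card E \<le> 2 * card Q - 2"
    "\<And>p. p \<in> Q \<Longrightarrow> walk_le E p r (\<delta> p - dist r c)"
    "\<And>p q. p \<in> Q \<Longrightarrow> q \<in> Q \<Longrightarrow> p \<noteq> q \<Longrightarrow> walk_le E p q (\<gamma> p q)"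
    by (elim hangE) auto
  show ?thesis
  proof (rule hangI[OF E(1,2)])
    show "walk_le E p r (\<delta>' p - dist r c)" if "p \<in> Q" for p
      using E(3)[OF that] assms(2)[OF that] by (auto intro: walk_le_mono)
    show "walk_le E p q (\<gamma>' p q)" if "p \<in> Q" "q \<in> Q" "p \<noteq> q" for p q
      using E(4)[OF that] assms(3)[OF that] by (auto intro: walk_le_mono)
  qed
qed (simp add: hang_def)

text \<open>No edge is spent: the pending edge is redirected, and the triangle inequality pays for
  it.\<close>

lemma hang_move:
  assumes "hang Q c \<delta> \<gamma>" "dist c b \<le> s"
  shows "hang Q b (\<lambda>p. \<delta> p + s) \<gamma>"
proof (cases "Q = {}")
  case False
  with assms(1) obtain E r where E: "finite E" "card E \<le> 2 * card Q - 2"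
    "\<And>p. p \<in> Q \<Longrightarrow> walk_le E p r (\<delta> p - dist r c)"
    "\<And>p q. p \<in> Q \<Longrightarrow> q \<in> Q \<Longrightarrow> p \<noteq> q \<Longrightarrow> walk_le E p q (\<gamma> p q)"
    by (elim hangE) auto
  show ?thesis
  proof (rule hangI[OF E(1,2) _ E(4)])
    show "walk_le E p r (\<delta> p + s - dist r b)" if "p \<in> Q" for p
      using E(3)[OF that] assms(2) dist_triangle[of r b c] by (auto intro: walk_le_mono)
  qed
qed (simp add: hang_def)

lemma hang_single:
  assumes "dist p c \<le> \<delta> p"
  shows "hang {p} c \<delta> \<gamma>"
  unfolding hang_def using assms
  by (intro disjI2 exI[of _ "{}"] exI[of _ p]) (auto intro: walk_le_refl)

text \<open>Only here do pending edges become real: two of them lead to \<open>c\<close>, the new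
  root, and the edge counts add up to \<open>2 * card (Q \<union> R) - 2\<close>. If one side is
  empty, no edge is added.\<close>

lemma hang_join:
  assumes "hang Q c \<delta> \<gamma>" "hang R c \<delta> \<gamma>" "finite Q" "finite R" "Q \<inter> R = {}"
    and \<gamma>: "\<And>p q. p \<in> Q \<Longrightarrow> q \<in> R \<Longrightarrow> \<delta> p + \<delta> q \<le> \<gamma> p q \<and> \<delta> p + \<delta> q \<le> \<gamma> q p"
  shows "hang (Q \<union> R) c \<delta> \<gamma>"
proof (cases "Q = {} \<or> R = {}")
  case True
  then show ?thesis using assms by auto
next
  case False
  \<comment> \<open>Nonempty sets keep the subtractions in the edge counts from being
    truncated.\<close>
  then have c: "card Q > 0" "card R > 0" "card (Q \<union> R) = card Q + card R"
    using assms by (auto simp: card_gt_0_iff card_Un_disjoint)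
  obtain E r where E: "finite E" "card E \<le> 2 * card Q - 2"
    "\<And>p. p \<in> Q \<Longrightarrow> walk_le E p r (\<delta> p - dist r c)"
    "\<And>p q. p \<in> Q \<Longrightarrow> q \<in> Q \<Longrightarrow> p \<noteq> q \<Longrightarrow> walk_le E p q (\<gamma> p q)"
    by (rule hangE[OF assms(1)]) (use False in auto)
  obtain F s where F: "finite F" "card F \<le> 2 * card R - 2"
    "\<And>p. p \<in> R \<Longrightarrow> walk_le F p s (\<delta> p - dist s c)"
    "\<And>p q. p \<in> R \<Longrightarrow> q \<in> R \<Longrightarrow> p \<noteq> q \<Longrightarrow> walk_le F p q (\<gamma> p q)"
    by (rule hangE[OF assms(2)]) (use False in auto)
  define G where "G = insert (r, c) (insert (s, c) (E \<union> F))"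
  have sub: "E \<subseteq> G" "F \<subseteq> G" by (auto simp: G_def)
  have "card G \<le> Suc (Suc (card E + card F))"
    unfolding G_def using card_Un_le[of E F] card_insert_le_m1 E F
    by (auto simp: card_insert_if)
  then have cG: "card G \<le> 2 * card (Q \<union> R) - 2"
    using E F c by linarith
  have q: "walk_le G p c (\<delta> p)" if "p \<in> Q" for p
    by (rule walk_le_trans[OF walk_le_mono[OF E(3)[OF that] sub(1) order.refl] walk_le_edge[OF _ order.refl, of r c]])
      (auto simp: G_def)
  have r: "walk_le G p c (\<delta> p)" if "p \<in> R" for p
    by (rule walk_le_trans[OF walk_le_mono[OF F(3)[OF that] sub(2) order.refl] walk_le_edge[OF _ order.refl, of s c]])
      (auto simp: G_def)
  have "walk_le G p q (\<gamma> p q)" if pq: "p \<in> Q \<union> R" "q \<in> Q \<union> R" "p \<noteq> q" for p q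
  proof -
    consider "p \<in> Q" "q \<in> Q" | "p \<in> R" "q \<in> R" | "p \<in> Q" "q \<in> R" | "p \<in> R" "q \<in> Q"
      using pq by blast
    then show ?thesis
    proof cases
      case 1
      then show ?thesis using E(4) walk_le_mono[OF _ sub(1)] pq by blast
    next
      case 2
      then show ?thesis using F(4) walk_le_mono[OF _ sub(2)] pq by blast
    next
      case 3
      then show ?thesis using walk_le_trans[OF q walk_le_sym[OF r]] \<gamma> by blast
    next
      case 4
      then show ?thesis using walk_le_trans[OF r walk_le_sym[OF q]] \<gamma> by (metis add.commute)
    qed
  qed
  moreover have "finite G" by (simp add: G_def E F)
  moreover have "walk_le G p c (\<delta> p - dist c c)" if "p \<in> Q \<union> R" for p
    using that q r by auto
  ultimately show ?thesis
    using cG by (intro hangI[where E = G and r = c]) auto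
qed

section \<open>Steiner trees built cell by cell\<close>

fun unzoom :: "quadrant \<Rightarrow> real \<times> real \<Rightarrow> real \<times> real" where
  "unzoom Near (x, y) = (x / 2, y / 2)"
| "unzoom Far (x, y) = ((x + 1) / 2, y / 2)"
| "unzoom Up (x, y) = ((1 - y) / 2, x / 2)"
| "unzoom Down (x, y) = ((1 + y) / 2, - x / 2)"

lemma unzoom_zoom [simp]: "unzoom k (zoom k z) = z"
  by (cases k; cases z) auto

lemma taxi_unzoom: "taxi (unzoom k z - unzoom k w) = taxi (z - w) / 2"
  by (cases k; cases z; cases w) (auto simp: taxi_def abs_if field_simps)

lemma taxi_diamond_le:
  assumes "z \<in> diamond" "w \<in> diamond"
  shows "taxi (z - w) \<le> 1"
  using assms by (auto simp: diamond_def taxi_def)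

lemma near_dist_Suc: "quadrant z \<noteq> Near \<Longrightarrow> near_dist (Suc n) z = 1/2 + centre_dist n z"
  by (simp add: centre_dist_def)

lemma far_dist_Suc: "quadrant z \<noteq> Far \<Longrightarrow> far_dist (Suc n) z = 1/2 + centre_dist n z"
  by (simp add: centre_dist_def)

text \<open>\<open>R\<close> collects the points that hang at the far end of the base of the cell.\<close>

lemma cell_steiner:
  fixes loc :: "'a::metric_space \<Rightarrow> real \<times> real" and \<phi> :: "real \<times> real \<Rightarrow> 'a"
  assumes "finite Q" "finite R" "Q \<inter> R = {}" "loc ` Q \<subseteq> diamond"
    and "\<And>z w. dist (\<phi> z) (\<phi> w) \<le> s * taxi (z - w)" "\<And>p. p \<in> Q \<Longrightarrow> \<phi> (loc p) = p"
    and "\<And>p q. p \<in> Q \<Longrightarrow> q \<in> Q \<Longrightarrow> p \<noteq> q \<Longrightarrow> 1 < 2 ^ n * taxi (loc p - loc q)"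
    and "hang R (\<phi> (1, 0)) \<delta> \<gamma>"
  shows "hang (Q \<union> R) (\<phi> (0, 0)) (\<lambda>p. if p \<in> Q then s * near_dist n (loc p) else \<delta> p + s)
     (\<lambda>p q. if p \<in> Q then if q \<in> Q then s * tree_dist n (loc p) (loc q)
                                 else s * far_dist n (loc p) + \<delta> q
            else if q \<in> Q then s * far_dist n (loc q) + \<delta> p else \<gamma> p q)"
  using assms
proof (induction n arbitrary: Q R loc \<phi> s \<delta> \<gamma>)
  case 0
  have "hang R (\<phi> (0, 0)) (\<lambda>p. \<delta> p + s) \<gamma>"
    using 0(8) 0(5)[of "(1, 0)" "(0, 0)"] by (intro hang_move) (auto simp: taxi_def)
  then have R: ?case if "Q = {}" using that by simp
  \<comment> \<open>At depth 0 the points are more than 1 apart in \<open>taxi\<close>, the diameter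
    of \<open>diamond\<close>, so there is at most one.\<close>
  have "p = q" if "p \<in> Q" "q \<in> Q" for p q
    using 0(7)[OF that] taxi_diamond_le[of "loc p" "loc q"] 0(4) that by force
  then consider "Q = {}" | p where "Q = {p}" by blast
  then show ?case
  proof cases
    case 1
    then show ?thesis by (rule R)
  next
    case 2
    obtain x y where xy: "loc p = (x, y)" by force
    have x: "0 \<le> x" "x \<le> 1" using 0(4) 2 xy by (auto simp: diamond_def)
    \<comment> \<open>Branching takes place at the foot (x, 0) of the perpendicular from
      \<open>p\<close>.\<close>
    let ?d = "\<lambda>q. if q = p then s * \<bar>y\<bar> else \<delta> q + s * (1 - x)"
    let ?g = "\<lambda>q r. if q = p then ?d p + ?d r else if r = p then ?d p + ?d q else \<gamma> q r"
    have "hang {p} (\<phi> (x, 0)) ?d ?g"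
      using 0(5)[of "(x, y)" "(x, 0)"] 0(6)[of p] xy 2 by (intro hang_single) (simp add: taxi_def)
    moreover have "hang R (\<phi> (x, 0)) ?d ?g"
    proof (rule hang_mono)
      show "hang R (\<phi> (x, 0)) (\<lambda>q. \<delta> q + s * (1 - x)) \<gamma>"
        using 0(8) 0(5)[of "(1, 0)" "(x, 0)"] x by (intro hang_move) (auto simp: taxi_def)
    qed (use 2 0(3) in auto)
    ultimately have "hang ({p} \<union> R) (\<phi> (x, 0)) ?d ?g"
      by (rule hang_join) (use 0 2 in auto)
    then have "hang ({p} \<union> R) (\<phi> (0, 0)) (\<lambda>q. ?d q + s * x) ?g"
      using 0(5)[of "(x, 0)" "(0, 0)"] x by (intro hang_move) (auto simp: taxi_def)
    then show ?thesis
      unfolding 2 by (rule hang_mono) (auto simp: xy algebra_simps)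
  qed
next
  case (Suc n)
  let ?Q = "\<lambda>k. {p \<in> Q. quadrant (loc p) = k}"
  let ?c = "\<phi> (1/2, 0)"
  \<comment> \<open>Each quadrant has its own coordinates \<open>zoom k\<close> and realisation
    \<open>\<phi> \<circ> unzoom k\<close> at half the scale; \<open>T\<close> already hangs at the
    far end of its base.\<close>
  have IH: "hang (?Q k \<union> T) (\<phi> (unzoom k (0, 0)))
       (\<lambda>p. if p \<in> ?Q k then s/2 * near_dist n (zoom k (loc p)) else \<alpha> p + s/2)
       (\<lambda>p q. if p \<in> ?Q k then if q \<in> ?Q k then s/2 * tree_dist n (zoom k (loc p)) (zoom k (loc q))
                                 else s/2 * far_dist n (zoom k (loc p)) + \<alpha> q
            else if q \<in> ?Q k then s/2 * far_dist n (zoom k (loc q)) + \<alpha> p else \<beta> p q)"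
    if "finite T" "?Q k \<inter> T = {}" "hang T (\<phi> (unzoom k (1, 0))) \<alpha> \<beta>" for k T \<alpha> \<beta>
  proof (rule Suc.IH[where \<phi> = "\<phi> \<circ> unzoom k" and loc = "zoom k \<circ> loc", unfolded o_def])
    show "(\<lambda>x. zoom k (loc x)) ` ?Q k \<subseteq> diamond"
      using zoom_diamond Suc.prems(4) by blast
    show "dist (\<phi> (unzoom k z)) (\<phi> (unzoom k w)) \<le> s/2 * taxi (z - w)" for z w
      using Suc.prems(5)[of "unzoom k z" "unzoom k w"] by (simp add: taxi_unzoom)
    show "1 < 2 ^ n * taxi (zoom k (loc p) - zoom k (loc q))"
      if "p \<in> ?Q k" "q \<in> ?Q k" "p \<noteq> q" for p q
      using Suc.prems(7)[of p q] taxi_zoom[of "loc p" "loc q"] that by auto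
  qed (use Suc.prems that in auto)
  \<comment> \<open>\<open>d\<close> is the cost of reaching the centre, where the parts will be
    joined; \<open>g\<close> is the final bound for pairs.\<close>
  define d where "d = (\<lambda>p. if p \<in> Q then s * centre_dist n (loc p) else \<delta> p + s/2)"
  define g where "g = (\<lambda>p q. if p \<in> Q then if q \<in> Q then s * tree_dist (Suc n) (loc p) (loc q)
                                 else s * far_dist (Suc n) (loc p) + \<delta> q
            else if q \<in> Q then s * far_dist (Suc n) (loc q) + \<delta> p else \<gamma> p q)"
  have u: "unzoom Near (0, 0) = (0, 0)" "unzoom Near (1, 0) = (1/2, 0)"
    "unzoom Far (0, 0) = (1/2, 0)" "unzoom Far (1, 0) = (1, 0)"
    "unzoom Up (0, 0) = (1/2, 0)" "unzoom Down (0, 0) = (1/2, 0)"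
    by simp_all
  \<comment> \<open>The base of \<open>Far\<close> leads from the centre to the point where
    \<open>R\<close> hangs, so \<open>R\<close> comes out hung at the centre.\<close>
  have far: "hang (?Q Far \<union> R) ?c d g"
  proof (rule hang_mono)
    show "hang (?Q Far \<union> R) ?c
       (\<lambda>p. if p \<in> ?Q Far then s/2 * near_dist n (zoom Far (loc p)) else \<delta> p + s/2)
       (\<lambda>p q. if p \<in> ?Q Far then if q \<in> ?Q Far then s/2 * tree_dist n (zoom Far (loc p)) (zoom Far (loc q))
                                 else s/2 * far_dist n (zoom Far (loc p)) + \<delta> q
            else if q \<in> ?Q Far then s/2 * far_dist n (zoom Far (loc q)) + \<delta> p else \<gamma> p q)"
      using IH[of R Far \<delta> \<gamma>, unfolded u] Suc.prems(2,3,8) by (simp only:) blast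
  qed (use Suc.prems(3) in \<open>auto simp: d_def g_def centre_dist_def\<close>)
  \<comment> \<open>Nothing hangs at the outer ends of these two bases.\<close>
  have side: "hang (?Q k) ?c d g" if "k = Up \<or> k = Down" for k
  proof (rule hang_mono)
    show "hang (?Q k) ?c
       (\<lambda>p. if p \<in> ?Q k then s/2 * near_dist n (zoom k (loc p)) else \<delta> p + s/2)
       (\<lambda>p q. if p \<in> ?Q k then if q \<in> ?Q k then s/2 * tree_dist n (zoom k (loc p)) (zoom k (loc q))
                                 else s/2 * far_dist n (zoom k (loc p)) + \<delta> q
            else if q \<in> ?Q k then s/2 * far_dist n (zoom k (loc q)) + \<delta> p else \<gamma> p q)"
      using IH[OF finite.emptyI Int_empty_right hang_empty, of k \<delta> \<gamma>] that
      by (elim disjE) (simp_all only: u Un_empty_right)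
  qed (use that in \<open>auto simp: d_def g_def centre_dist_def\<close>)
  have cross: "d p + d q \<le> g p q \<and> d p + d q \<le> g q p" if "p \<in> Q" "q \<in> Q" "quadrant (loc p) \<noteq> quadrant (loc q)" for p q
    using that by (simp add: d_def g_def algebra_simps)
  have cross': "d p + d q \<le> g p q \<and> d p + d q \<le> g q p"
    if "p \<in> Q" "q \<in> R" "quadrant (loc p) \<noteq> Far" for p q
  proof -
    have "q \<notin> Q" using that Suc.prems(3) by auto
    then show ?thesis using that far_dist_Suc[of "loc p" n] by (simp add: d_def g_def algebra_simps del: far_dist.simps)
  qed
  have cross'': "d q + d p \<le> g q p \<and> d q + d p \<le> g p q"
    if "p \<in> Q" "q \<in> R" "quadrant (loc p) \<noteq> Far" for p q
    using cross'[OF that] by linarith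
  let ?T = "(?Q Far \<union> R) \<union> (?Q Up \<union> ?Q Down)"
  have "hang (?Q Up \<union> ?Q Down) ?c d g"
    by (rule hang_join[OF side side]) (use Suc.prems cross in auto)
  then have tail: "hang ?T ?c d g"
    by (intro hang_join[OF far]) (use Suc.prems cross cross' cross'' in auto)
  have "?Q Near \<union> ?T = Q \<union> R"
    by auto (metis quadrant.exhaust)
  \<comment> \<open>The base of \<open>Near\<close> ends at the centre, so all that was joined there
    takes the place of \<open>R\<close>.\<close>
  moreover have "hang (?Q Near \<union> ?T) (\<phi> (0, 0))
       (\<lambda>p. if p \<in> ?Q Near then s/2 * near_dist n (zoom Near (loc p)) else d p + s/2)
       (\<lambda>p q. if p \<in> ?Q Near then if q \<in> ?Q Near then s/2 * tree_dist n (zoom Near (loc p)) (zoom Near (loc q))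
                                 else s/2 * far_dist n (zoom Near (loc p)) + d q
            else if q \<in> ?Q Near then s/2 * far_dist n (zoom Near (loc q)) + d p else g p q)"
    by (rule IH[of ?T Near d g, unfolded u]) (use Suc.prems tail in \<open>auto simp del: Un_iff\<close>)
  ultimately have "hang (Q \<union> R) (\<phi> (0, 0))
       (\<lambda>p. if p \<in> ?Q Near then s/2 * near_dist n (zoom Near (loc p)) else d p + s/2)
       (\<lambda>p q. if p \<in> ?Q Near then if q \<in> ?Q Near then s/2 * tree_dist n (zoom Near (loc p)) (zoom Near (loc q))
                                 else s/2 * far_dist n (zoom Near (loc p)) + d q
            else if q \<in> ?Q Near then s/2 * far_dist n (zoom Near (loc q)) + d p else g p q)"
    by simp
  then show ?case
  proof (rule hang_mono)
    fix p assume "p \<in> Q \<union> R"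
    then show "(if p \<in> ?Q Near then s/2 * near_dist n (zoom Near (loc p)) else d p + s/2)
      \<le> (if p \<in> Q then s * near_dist (Suc n) (loc p) else \<delta> p + s)"
      by (auto simp: d_def centre_dist_def algebra_simps)
  next
    fix p q assume "p \<in> Q \<union> R" "q \<in> Q \<union> R"
    then show "(if p \<in> ?Q Near then if q \<in> ?Q Near then s/2 * tree_dist n (zoom Near (loc p)) (zoom Near (loc q))
                                 else s/2 * far_dist n (zoom Near (loc p)) + d q
            else if q \<in> ?Q Near then s/2 * far_dist n (zoom Near (loc q)) + d p else g p q)
       \<le> (if p \<in> Q then if q \<in> Q then s * tree_dist (Suc n) (loc p) (loc q)
                                 else s * far_dist (Suc n) (loc p) + \<delta> q
            else if q \<in> Q then s * far_dist (Suc n) (loc q) + \<delta> p else \<gamma> p q)"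
      by (auto simp: d_def g_def centre_dist_def algebra_simps)
  qed
qed

section \<open>Trees without Steiner points\<close>

lemma taxi_nonneg: "taxi z \<ge> 0"
  by (simp add: taxi_def)

lemma taxi_triangle: "taxi (z - w) \<le> taxi (z - u) + taxi (u - w)"
  by (simp add: taxi_def)

lemma taxi_minus_commute: "taxi (z - w) = taxi (w - z)"
  by (simp add: taxi_def abs_minus_commute)

definition centre_end :: "quadrant \<Rightarrow> real \<times> real" where
  "centre_end k = (if k = Near then (1, 0) else (0, 0))"

lemma taxi_zoom_centre: "taxi (zoom k z - centre_end k) = 2 * taxi (z - (1/2, 0))"
  by (cases k; cases z) (auto simp: taxi_def centre_end_def abs_if)

lemma taxi_zoom_ends:
  "taxi (zoom Near z) = 2 * taxi z" "taxi (zoom Far z - (1, 0)) = 2 * taxi (z - (1, 0))"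
  by (cases z; auto simp: taxi_def abs_if)+

lemma taxi_diamond:
  assumes "z \<in> diamond"
  shows "taxi z + taxi (z - (1, 0)) \<le> 2" "taxi (z - (1/2, 0)) \<le> 1/2"
  using assms by (auto simp: diamond_def taxi_def abs_if split: if_splits)

text \<open>
  The points \<open>a\<close> and \<open>b\<close> of \<open>Q\<close> stand in for the ends of the base. The credit \<open>2 * taxi\<close> pays for
  connecting them: twice the distance to the centre covers both the edge to the closest
  representative and the way on from there.
\<close>

definition cell_tree ::
    "nat \<Rightarrow> real \<Rightarrow> ('a::metric_space \<Rightarrow> real \<times> real) \<Rightarrow> 'a set \<Rightarrow> ('a \<times> 'a) set \<Rightarrow> 'a \<Rightarrow> 'a \<Rightarrow> bool" where
  "cell_tree n s loc Q E a b \<longleftrightarrow> E \<subseteq> Q \<times> Q \<and> card E \<le> card Q - 1 \<and> a \<in> Q \<and> b \<in> Q \<and>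
     (\<forall>p\<in>Q. walk_le E p a (s * (4 * near_dist n (loc p) - 2 * taxi (loc a)))) \<and>
     (\<forall>p\<in>Q. walk_le E p b (s * (4 * far_dist n (loc p) - 2 * taxi (loc b - (1, 0))))) \<and>
     walk_le E a b (s * (4 - 2 * taxi (loc a) - 2 * taxi (loc b - (1, 0)))) \<and>
     (\<forall>p\<in>Q. \<forall>q\<in>Q. p \<noteq> q \<longrightarrow> walk_le E p q (s * (4 * tree_dist n (loc p) (loc q))))"

text \<open>The representatives of the nonempty quadrants at the centre are all joined to the
  closest one. Each new edge costs at most twice the distance from its representative to the centre,
  which is the credit kept in that quadrant's tree.\<close>

lemma cell_spanner:
  fixes loc :: "'a::metric_space \<Rightarrow> real \<times> real"
  assumes "finite Q" "Q \<noteq> {}" "loc ` Q \<subseteq> diamond" "s \<ge> 0"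
    and "\<And>p q. p \<in> Q \<Longrightarrow> q \<in> Q \<Longrightarrow> dist p q \<le> s * taxi (loc p - loc q)"
    and "\<And>p q. p \<in> Q \<Longrightarrow> q \<in> Q \<Longrightarrow> p \<noteq> q \<Longrightarrow> 1 < 2 ^ n * taxi (loc p - loc q)"
  shows "\<exists>E a b. cell_tree n s loc Q E a b"
  using assms
proof (induction n arbitrary: Q loc s)
  case 0
  have "p = q" if "p \<in> Q" "q \<in> Q" for p q
    using 0(6)[OF that] taxi_diamond_le[of "loc p" "loc q"] 0(3) that by force
  with 0(2) obtain p where p: "Q = {p}" by blast
  obtain x y where xy: "loc p = (x, y)" by force
  have d: "\<bar>y\<bar> \<le> x" "\<bar>y\<bar> \<le> 1 - x" using 0(3) p xy by (auto simp: diamond_def)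
  \<comment> \<open>The single point represents both ends, and each bound only has to be
    nonnegative; the one between the ends is \<open>2 - 4 * \<bar>y\<bar>\<close> times
    \<open>s\<close>.\<close>
  show ?case
    unfolding p cell_tree_def using d 0(4)
    by (intro exI[of _ "{}"] exI[of _ p]) (auto simp: xy taxi_def intro!: walk_le_refl mult_nonneg_nonneg)
next
  case (Suc n)
  let ?Q = "\<lambda>k. {p \<in> Q. quadrant (loc p) = k}"
  define I where "I = (\<lambda>p. quadrant (loc p)) ` Q"
  have I: "finite I" "I \<noteq> {}" using Suc.prems by (auto simp: I_def)
  have "\<exists>E a b. cell_tree n (s/2) (\<lambda>p. zoom k (loc p)) (?Q k) E a b"
    if "k \<in> I" for k
  proof (rule Suc.IH)
    show "?Q k \<noteq> {}" using that by (auto simp: I_def)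
    show "(\<lambda>x. zoom k (loc x)) ` ?Q k \<subseteq> diamond"
      using zoom_diamond Suc.prems(3) by blast
    show "dist p q \<le> s/2 * taxi (zoom k (loc p) - zoom k (loc q))" if "p \<in> ?Q k" "q \<in> ?Q k" for p q
      using Suc.prems(5)[of p q] taxi_zoom[of "loc p" "loc q"] that by auto
    show "1 < 2 ^ n * taxi (zoom k (loc p) - zoom k (loc q))"
      if "p \<in> ?Q k" "q \<in> ?Q k" "p \<noteq> q" for p q
      using Suc.prems(6)[of p q] taxi_zoom[of "loc p" "loc q"] that by auto
  qed (use Suc.prems in auto)
  then obtain E a b where T:
    "\<And>k. k \<in> I \<Longrightarrow> cell_tree n (s/2) (\<lambda>p. zoom k (loc p)) (?Q k) (E k) (a k) (b k)"
    by metis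
  have E: "\<And>k. k \<in> I \<Longrightarrow> E k \<subseteq> ?Q k \<times> ?Q k" "\<And>k. k \<in> I \<Longrightarrow> card (E k) \<le> card (?Q k) - 1"
    and ab: "\<And>k. k \<in> I \<Longrightarrow> a k \<in> ?Q k" "\<And>k. k \<in> I \<Longrightarrow> b k \<in> ?Q k"
    and Ea: "\<And>k p. k \<in> I \<Longrightarrow> p \<in> ?Q k \<Longrightarrow>
      walk_le (E k) p (a k) (s/2 * (4 * near_dist n (zoom k (loc p)) - 2 * taxi (zoom k (loc (a k)))))"
    and Eb: "\<And>k p. k \<in> I \<Longrightarrow> p \<in> ?Q k \<Longrightarrow>
      walk_le (E k) p (b k) (s/2 * (4 * far_dist n (zoom k (loc p)) - 2 * taxi (zoom k (loc (b k)) - (1, 0))))"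
    and Eab: "\<And>k. k \<in> I \<Longrightarrow> walk_le (E k) (a k) (b k)
      (s/2 * (4 - 2 * taxi (zoom k (loc (a k))) - 2 * taxi (zoom k (loc (b k)) - (1, 0))))"
    and Epq: "\<And>k p q. k \<in> I \<Longrightarrow> p \<in> ?Q k \<Longrightarrow> q \<in> ?Q k \<Longrightarrow> p \<noteq> q \<Longrightarrow>
      walk_le (E k) p q (s/2 * (4 * tree_dist n (zoom k (loc p)) (zoom k (loc q))))"
    using T unfolding cell_tree_def by blast+
  \<comment> \<open>\<open>v k\<close> stands for the end of the base of quadrant \<open>k\<close>
    at the centre; \<open>w\<close> is the scaled distance to the centre.\<close>
  define v where "v k = (if k = Near then b k else a k)" for k
  define w where "w p = s * taxi (loc p - (1/2, 0))" for p
  have vQ: "v k \<in> ?Q k" if "k \<in> I" for k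
    using ab[OF that] by (cases "k = Near") (simp_all add: v_def)
  have w0: "0 \<le> w p" for p
    using taxi_nonneg Suc.prems(4) by (simp add: w_def)
  have w1: "w p \<le> s / 2" if "p \<in> Q" for p
  proof -
    have "loc p \<in> diamond" using that Suc.prems(3) by auto
    then show ?thesis
      using mult_left_mono[OF taxi_diamond(2) Suc.prems(4)] by (simp add: w_def)
  qed
  have Ev: "walk_le (E k) p (v k) (4 * s * centre_dist n (loc p) - 2 * w (v k))" if "k \<in> I" "p \<in> ?Q k" for k p
    using Ea[OF that] Eb[OF that] that(2) taxi_zoom_centre[of k "loc (v k)"]
    by (auto simp: centre_end_def v_def w_def centre_dist_def algebra_simps simp flip: zero_prod_def split: if_splits)
  obtain k0 where k0: "k0 \<in> I" "\<And>k. k \<in> I \<Longrightarrow> w (v k0) \<le> w (v k)"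
    using ex_min_if_finite[of "(\<lambda>k. w (v k)) ` I"] I by (auto simp: not_less)
  define V where "V = v k0"
  have VQ: "V \<in> Q" "w V \<le> s / 2" using vQ[OF k0(1)] w1 by (auto simp: V_def)
  define F where "F = (\<Union>k\<in>I. E k) \<union> (\<lambda>k. (v k, V)) ` (I - {k0})"
  have EF: "E k \<subseteq> F" if "k \<in> I" for k using that by (auto simp: F_def)
  have FQ: "F \<subseteq> Q \<times> Q" using E(1) vQ VQ by (fastforce simp: F_def)
  \<comment> \<open>Trees with one edge less than points, plus one connecting edge less than
    nonempty quadrants.\<close>
  have cF: "card F \<le> card Q - 1"
  proof -
    have "card F \<le> (\<Sum>k\<in>I. card (E k)) + card (I - {k0})"
      unfolding F_def using card_UN_le[OF I(1), of E] card_image_le[of "I - {k0}" "\<lambda>k. (v k, V)"] I(1)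
      by (intro order.trans[OF card_Un_le]) auto
    also have "\<dots> \<le> (\<Sum>k\<in>I. card (?Q k) - 1) + (card I - 1)"
      using E(2) k0(1) by (intro add_mono sum_mono) auto
    also have "(\<Sum>k\<in>I. card (?Q k) - 1) = (\<Sum>k\<in>I. card (?Q k)) - card I"
    proof -
      have "1 \<le> card (?Q k)" if "k \<in> I" for k
        using ab(1)[OF that] Suc.prems(1) by (auto simp: Suc_le_eq card_gt_0_iff)
      then show ?thesis by (subst sum_subtractf_nat) auto
    qed
    also have "(\<Sum>k\<in>I. card (?Q k)) = card Q"
    proof -
      have "card (\<Union>k\<in>I. ?Q k) = (\<Sum>k\<in>I. card (?Q k))"
        using I Suc.prems(1) by (intro card_UN_disjoint) auto
      moreover have "(\<Union>k\<in>I. ?Q k) = Q" by (auto simp: I_def)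
      ultimately show ?thesis by simp
    qed
    finally have "card F \<le> card Q - card I + (card I - 1)" .
    moreover have "card I \<le> card Q" unfolding I_def by (rule card_image_le[OF Suc.prems(1)])
    moreover have "card I > 0" using I by (simp add: card_gt_0_iff)
    ultimately show ?thesis by linarith
  qed
  have dV: "dist (v k) V \<le> w (v k) + w V" if "k \<in> I" for k
  proof -
    have "dist (v k) V \<le> s * taxi (loc (v k) - loc V)"
      using Suc.prems(5) vQ[OF that] VQ by auto
    also have "\<dots> \<le> s * (taxi (loc (v k) - (1/2, 0)) + taxi ((1/2, 0) - loc V))"
      using Suc.prems(4) taxi_triangle by (rule mult_left_mono[rotated])
    finally show ?thesis by (simp add: w_def taxi_minus_commute algebra_simps)
  qed
  \<comment> \<open>\<open>w V\<close> is minimal, so the edge length \<open>w (v k) + w V\<close>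
    is at most \<open>2 * w (v k)\<close>.\<close>
  have toV: "walk_le F (v k) V (2 * w (v k))" if "k \<in> I" for k
  proof (cases "k = k0")
    case True
    then show ?thesis using w0 by (auto simp: V_def intro: walk_le_refl)
  next
    case False
    then show ?thesis
      using dV[OF that] k0(2)[OF that] that by (intro walk_le_edge) (auto simp: F_def V_def)
  qed
  have pV: "walk_le F p V (4 * s * centre_dist n (loc p))" if "p \<in> Q" for p
  proof -
    have k: "quadrant (loc p) \<in> I" "p \<in> ?Q (quadrant (loc p))" using that by (auto simp: I_def)
    show ?thesis
      by (rule walk_le_trans[OF walk_le_mono[OF Ev[OF k] EF[OF k(1)] order.refl] toV[OF k(1)]]) simp
  qed
  \<comment> \<open>If the quadrant at an end of the base is empty, \<open>V\<close> stands in for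
    that end. It is within 1 of both ends, so a budget of 2 still covers the credit.\<close>
  define A where "A = (if Near \<in> I then a Near else V)"
  define B where "B = (if Far \<in> I then b Far else V)"
  have AQ: "A \<in> Q" "B \<in> Q" using ab VQ by (auto simp: A_def B_def)
  have wV: "s * taxi (loc V) \<le> s" "s * taxi (loc V - (1, 0)) \<le> s"
    using mult_left_mono[OF taxi_triangle[of "loc V" 0 "(1/2, 0)"] Suc.prems(4)]
      mult_left_mono[OF taxi_triangle[of "loc V" "(1, 0)" "(1/2, 0)"] Suc.prems(4)] VQ(2)
    by (auto simp: w_def taxi_def algebra_simps)
  \<comment> \<open>Crossing \<open>Near\<close> from end to end leaves credit at its centre end,
    which pays for the way from \<open>V\<close> to \<open>v Near\<close>.\<close>
  have VA: "walk_le F V A (s * (2 - 2 * taxi (loc A)))"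
  proof (cases "Near \<in> I")
    case True
    have "walk_le F (v Near) A (s * (2 - 2 * taxi (loc A)) - 2 * w (v Near))"
      using walk_le_mono[OF Eab[OF True, THEN walk_le_sym] EF[OF True] order.refl] True
        taxi_zoom_centre[of Near "loc (v Near)"]
      by (simp add: A_def v_def w_def centre_end_def taxi_zoom_ends algebra_simps)
    with walk_le_sym[OF toV[OF True]] show ?thesis by (rule walk_le_trans) simp
  next
    case False
    then show ?thesis using wV by (auto simp: A_def algebra_simps intro: walk_le_refl)
  qed
  have VB: "walk_le F V B (s * (2 - 2 * taxi (loc B - (1, 0))))"
  proof (cases "Far \<in> I")
    case True
    have "walk_le F (v Far) B (s * (2 - 2 * taxi (loc B - (1, 0))) - 2 * w (v Far))"
      using walk_le_mono[OF Eab[OF True] EF[OF True] order.refl] True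
        taxi_zoom_centre[of Far "loc (v Far)"]
      by (simp add: B_def v_def w_def centre_end_def taxi_zoom_ends algebra_simps flip: zero_prod_def)
    with walk_le_sym[OF toV[OF True]] show ?thesis by (rule walk_le_trans) simp
  next
    case False
    then show ?thesis using wV by (auto simp: B_def algebra_simps intro: walk_le_refl)
  qed
  have "walk_le F p A (s * (4 * near_dist (Suc n) (loc p) - 2 * taxi (loc A)))" if "p \<in> Q" for p
  proof (cases "quadrant (loc p) = Near")
    case True
    then have k: "Near \<in> I" "p \<in> ?Q Near" using that by (auto simp: I_def image_iff) metis
    show ?thesis
      using walk_le_mono[OF Ea[OF k] EF[OF k(1)] order.refl] True k(1)
      by (simp add: A_def taxi_zoom_ends algebra_simps)
  next
    case False
    show ?thesis
      by (rule walk_le_trans[OF pV[OF that] VA])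
        (simp only: near_dist_Suc[OF False], simp add: algebra_simps)
  qed
  moreover have "walk_le F p B (s * (4 * far_dist (Suc n) (loc p) - 2 * taxi (loc B - (1, 0))))"
    if "p \<in> Q" for p
  proof (cases "quadrant (loc p) = Far")
    case True
    then have k: "Far \<in> I" "p \<in> ?Q Far" using that by (auto simp: I_def image_iff) metis
    show ?thesis
      using walk_le_mono[OF Eb[OF k] EF[OF k(1)] order.refl] True k(1)
      by (simp add: B_def taxi_zoom_ends algebra_simps)
  next
    case False
    show ?thesis
      by (rule walk_le_trans[OF pV[OF that] VB])
        (simp only: far_dist_Suc[OF False], simp add: algebra_simps)
  qed
  moreover have "walk_le F A B (s * (4 - 2 * taxi (loc A) - 2 * taxi (loc B - (1, 0))))"
    by (rule walk_le_trans[OF walk_le_sym[OF VA] VB]) (simp add: algebra_simps)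
  moreover have "walk_le F p q (s * (4 * tree_dist (Suc n) (loc p) (loc q)))"
    if "p \<in> Q" "q \<in> Q" "p \<noteq> q" for p q
  proof (cases "quadrant (loc p) = quadrant (loc q)")
    case True
    then have k: "quadrant (loc q) \<in> I" "p \<in> ?Q (quadrant (loc q))" "q \<in> ?Q (quadrant (loc q))"
      using that by (auto simp: I_def)
    show ?thesis
      using walk_le_mono[OF Epq[OF k that(3)] EF[OF k(1)] order.refl] True by (simp add: algebra_simps)
  next
    case False
    then show ?thesis
      by (intro walk_le_trans[OF pV[OF that(1)] walk_le_sym[OF pV[OF that(2)]]])
        (simp add: algebra_simps)
  qed
  ultimately show ?case
    unfolding cell_tree_def using FQ cF AQ by blast
qed

section \<open>Spanners from pairs of trees\<close>

text \<open>Steiner vertices are named by their positions. Joining twice at one centre puts a loop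
  into \<open>E\<close>, which is dropped here.\<close>

definition edge_graph :: "'a set \<Rightarrow> ('a \<times> 'a) set \<Rightarrow> 'a pair_pre_digraph" where
  "edge_graph P E = \<lparr>pverts = P \<union> fst ` E \<union> snd ` E,
     parcs = {(u, v). u \<noteq> v \<and> ((u, v) \<in> E \<or> (v, u) \<in> E)}\<rparr>"

lemma edge_graph_simps:
  "pverts (edge_graph P E) = P \<union> fst ` E \<union> snd ` E"
  "parcs (edge_graph P E) = {(u, v). u \<noteq> v \<and> ((u, v) \<in> E \<or> (v, u) \<in> E)}"
  by (simp_all add: edge_graph_def)

lemma pair_graph_edge_graph:
  assumes "finite P" "finite E"
  shows "pair_graph (edge_graph P E)"
proof -
  have "parcs (edge_graph P E) \<subseteq> E \<union> E\<inverse>"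
    by (auto simp: edge_graph_simps)
  then have fin: "finite (parcs (edge_graph P E))"
    using assms by (auto intro: finite_subset)
  show ?thesis
  proof
    show "symmetric (with_proj (edge_graph P E))"
      by (auto simp: symmetric_def sym_def edge_graph_simps)
  qed (use assms fin in \<open>auto simp: edge_graph_simps image_iff\<close>; force)+
qed

lemma card_undirected_edges_edge_graph:
  assumes "finite E"
  shows "card (undirected_edges (edge_graph P E)) \<le> card E"
proof (rule surj_card_le[OF assms])
  show "undirected_edges (edge_graph P E) \<subseteq> (\<lambda>(u, v). {u, v}) ` E"
    by (fastforce simp: undirected_edges_def edge_graph_simps insert_commute)
qed

lemma graph_distance_le:
  fixes E :: "((real^2) \<times> (real^2)) set"
  assumes "finite P" "finite E" "walk_le E x y r" "x \<in> P"
  shows "graph_distance (edge_graph P E) euclidean_weight x y \<le> ereal r"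
proof -
  let ?G = "edge_graph P E"
  interpret G: pair_graph ?G by (rule pair_graph_edge_graph[OF assms(1,2)])
  have "x \<in> pverts ?G" using assms(4) by (simp add: edge_graph_simps)
  with assms(3) have "\<exists>p. G.awalk x p y \<and> G.awalk_cost euclidean_weight p \<le> r"
  proof (induction)
    case (walk_le_refl r x)
    then show ?case by (intro exI[of _ "[]"]) (simp add: G.awalk_Nil_iff)
  next
    case (walk_le_step x y z r s)
    have "y \<in> pverts ?G" using walk_le_step(1) by (force simp: edge_graph_simps)
    then obtain p where p: "G.awalk y p z" "G.awalk_cost euclidean_weight p \<le> r"
      using walk_le_step by blast
    show ?case
    \<comment> \<open>Loops of \<open>E\<close> have length 0 and are skipped.\<close>
    proof (cases "x = y")
      case True
      then show ?thesis using p walk_le_step(3) by auto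
    next
      case False
      then have "(x, y) \<in> parcs ?G" using walk_le_step(1) by (simp add: edge_graph_simps)
      then show ?thesis
        using p walk_le_step(3) walk_le_step.prems
        by (intro exI[of _ "(x, y) # p"]) (simp add: G.awalk_Cons_iff euclidean_weight_def dist_norm)
    qed
  qed
  then obtain p where "G.awalk x p y" "G.awalk_cost euclidean_weight p \<le> r" by blast
  then show ?thesis
    unfolding graph_distance_def using G.min_cost_le_walk_cost[of x p y euclidean_weight]
    by (meson ereal_less_eq(3) order_trans)
qed

text \<open>The triangle inequality along a walk. This is the lower bound for Steiner spanners,
  whose edges also carry Euclidean lengths.\<close>

lemma norm_le_graph_distance:
  assumes "pair_graph G"
  shows "ereal (norm (x - y)) \<le> graph_distance G euclidean_weight x y"
proof -
  interpret G: pair_graph G by fact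
  have "norm (x - y) \<le> G.awalk_cost euclidean_weight p" if "G.awalk x p y" for p
    using that
  proof (induction p arbitrary: x)
    case Nil
    then show ?case by (simp add: G.awalk_Nil_iff)
  next
    case (Cons e p)
    then have "norm (snd e - y) \<le> G.awalk_cost euclidean_weight p" "fst e = x"
      by (auto simp: G.awalk_Cons_iff)
    then show ?case
      using norm_triangle_ineq[of "x - snd e" "snd e - y"]
      by (cases e) (simp add: euclidean_weight_def)
  qed
  then show ?thesis
    unfolding graph_distance_def G.\<mu>_def by (auto intro!: INF_greatest)
qed

section \<open>Coordinates for the given points\<close>

lemma norm_le_taxi: "norm z \<le> taxi z"
  by (cases z) (simp add: taxi_def norm_Pair sqrt_sum_squares_le_sum_abs)

lemma norm_rotate: "norm (a + b, a - b :: real) = sqrt 2 * norm (a, b)"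
  by (simp add: norm_Pair power2_eq_square algebra_simps flip: real_sqrt_mult)

text \<open>The second cell has the left leg of the upper half of the first one as its base.\<close>

lemma two_frames:
  fixes P :: "(real^2) set"
  assumes "finite P"
  obtains l h :: "real^2 \<Rightarrow> real \<times> real" and f g and s t :: real and n where
    "s \<ge> 0" "t \<ge> 0" "l ` P \<subseteq> diamond" "h ` P \<subseteq> diamond"
    "\<And>p. f (l p) = p" "\<And>p. g (h p) = p"
    "\<And>z w. dist (f z) (f w) \<le> s * taxi (z - w)" "\<And>z w. dist (g z) (g w) \<le> t * taxi (z - w)"
    "\<And>p q. p \<in> P \<Longrightarrow> q \<in> P \<Longrightarrow> p \<noteq> q \<Longrightarrow> 1 < 2 ^ n * taxi (l p - l q)"
    "\<And>p q. p \<in> P \<Longrightarrow> q \<in> P \<Longrightarrow> p \<noteq> q \<Longrightarrow> 1 < 2 ^ n * taxi (h p - h q)"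
    "\<And>p q. p \<in> P \<Longrightarrow> q \<in> P \<Longrightarrow> s * tree_dist n (l p) (l q) \<le> sqrt 26 * norm (p - q) \<or>
       t * tree_dist n (h p) (h q) \<le> sqrt 26 * norm (p - q)"
proof -
  obtain M where M: "\<And>p. p \<in> P \<Longrightarrow> norm p \<le> M" "M > 0"
    using finite_imp_bounded[OF assms] unfolding bounded_pos by blast
  \<comment> \<open>Coordinates divided by \<open>s\<close> are at most 1/8 in absolute value, so
    the offsets 3/8 and 1/8 put \<open>l p\<close> into [1/4, 1/2] x [0, 1/4], inside the triangle
    of \<open>coupled\<close>.\<close>
  define s where "s = 8 * M"
  have s: "s > 0" using M by (simp add: s_def)
  define l where "l p = (3/8 + p $ 1 / s, 1/8 + p $ 2 / s)" for p :: "real^2"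
  \<comment> \<open>A reflection with a stretch by \<open>sqrt 2\<close>, hence the scale
    \<open>s / sqrt 2\<close> of the second frame.\<close>
  define h where "h p = (fst (l p) + snd (l p), fst (l p) - snd (l p))" for p :: "real^2"
  define f where "f z = (vector [s * (fst z - 3/8), s * (snd z - 1/8)] :: real^2)" for z
  define g where "g z = f ((fst z + snd z) / 2, (fst z - snd z) / 2)" for z
  have fl: "f (l p) = p" for p
    using s by (simp add: f_def l_def vec_eq_iff forall_2 vector_2)
  have gh: "g (h p) = p" for p
    using fl[of p] by (simp add: g_def h_def)
  have df: "dist (f z) (f w) = s * norm (z - w)" for z w
  proof -
    have "dist (f z) (f w) = sqrt (s\<^sup>2 * ((fst z - fst w)\<^sup>2 + (snd z - snd w)\<^sup>2))"
      by (simp add: dist_norm norm_vec_def L2_set_def sum_2 f_def vector_2 power2_eq_square algebra_simps)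
    then show ?thesis
      using s by (cases z; cases w) (simp add: real_sqrt_mult norm_Pair)
  qed
  have rot: "norm (h p - h q) = sqrt 2 * norm (l p - l q)" for p q
    using norm_rotate[of "fst (l p) - fst (l q)" "snd (l p) - snd (l q)"]
    by (cases "l p"; cases "l q") (simp add: h_def algebra_simps)
  have dg: "dist (g z) (g w) = s / sqrt 2 * norm (z - w)" for z w
  proof -
    define a b where "a = (fst z - fst w) / 2" and "b = (snd z - snd w) / 2"
    have "z - w = (2 * a, 2 * b)" by (cases z; cases w) (simp add: a_def b_def)
    then have "z - w = 2 *\<^sub>R (a, b)" by simp
    then have "norm (z - w) = 2 * norm (a, b)" by (simp only: norm_scaleR)
    moreover have "((fst z + snd z) / 2, (fst z - snd z) / 2) - ((fst w + snd w) / 2, (fst w - snd w) / 2)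
        = (a + b, a - b)"
      by (simp add: a_def b_def field_simps)
    then have "dist (g z) (g w) = s * norm (a + b, a - b)"
      by (simp only: g_def df)
    ultimately show ?thesis
      using real_sqrt_mult_self[of 2] by (simp add: norm_rotate field_simps)
  qed
  have nl: "norm (p - q) = s * norm (l p - l q)" for p q
    using df[of "l p" "l q"] by (simp add: fl dist_norm)
  have cpl: "coupled False False False False (l p) (h p)" if "p \<in> P" for p
  proof -
    have "\<bar>p $ 1\<bar> \<le> s / 8" "\<bar>p $ 2\<bar> \<le> s / 8"
      using component_le_norm_cart[of p] M(1)[OF that] order_trans unfolding s_def by auto
    then have "\<bar>p $ 1\<bar> / s \<le> 1/8" "\<bar>p $ 2\<bar> / s \<le> 1/8"
      using s by (simp_all add: pos_divide_le_eq)
    moreover define a b where "a = p $ 1 / s" and "b = p $ 2 / s"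
    ultimately have "\<bar>a\<bar> \<le> 1/8" "\<bar>b\<bar> \<le> 1/8"
      using s by (simp_all add: abs_divide)
    then show ?thesis
      unfolding coupled_def h_def l_def a_def[symmetric] b_def[symmetric] Let_def by auto
  qed
  obtain d where d: "d > 0" "\<And>p q. p \<in> P \<Longrightarrow> q \<in> P \<Longrightarrow> p \<noteq> q \<Longrightarrow> d \<le> norm (p - q)"
  proof -
    \<comment> \<open>The element 1 keeps \<open>D\<close> nonempty when there are no two distinct
      points.\<close>
    define D where "D = insert 1 ((\<lambda>(p, q). norm (p - q)) ` {(p, q) \<in> P \<times> P. p \<noteq> q})"
    have "finite ({(p, q) \<in> P \<times> P. p \<noteq> q})"
      by (rule finite_subset[of _ "P \<times> P"]) (use assms in auto)
    then have "finite D" by (simp add: D_def)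
    then show thesis
      by (intro that[of "Min D"]) (auto simp: D_def intro!: Min_le)
  qed
  \<comment> \<open>Distinct points are at least \<open>d / s\<close> apart in the first frame and
    farther in the second, so one depth separates them in both.\<close>
  obtain n where n: "s / d < 2 ^ n" using real_arch_pow[of 2 "s / d"] by auto
  have sep: "1 < 2 ^ n * norm (l p - l q)" if "p \<in> P" "q \<in> P" "p \<noteq> q" for p q
  proof -
    have "s < 2 ^ n * d" using n d by (simp add: field_simps)
    also have "\<dots> \<le> 2 ^ n * (s * norm (l p - l q))"
      using d(2)[OF that] by (simp add: nl)
    finally show ?thesis using s by (simp add: algebra_simps)
  qed
  show thesis
  proof (rule that[of s "s / sqrt 2" l h f g n])
    show "l ` P \<subseteq> diamond" "h ` P \<subseteq> diamond" using coupled_diamond cpl by blast+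
    show "dist (f z) (f w) \<le> s * taxi (z - w)" for z w
      using norm_le_taxi s by (simp add: df)
    show "dist (g z) (g w) \<le> s / sqrt 2 * taxi (z - w)" for z w
      unfolding dg by (rule mult_left_mono[OF norm_le_taxi]) (use s in simp)
    show "1 < 2 ^ n * taxi (l p - l q)" if "p \<in> P" "q \<in> P" "p \<noteq> q" for p q
      using less_le_trans[OF sep[OF that] mult_left_mono[OF norm_le_taxi]] by simp
    show "1 < 2 ^ n * taxi (h p - h q)" if "p \<in> P" "q \<in> P" "p \<noteq> q" for p q
    proof -
      have "norm (l p - l q) \<le> norm (h p - h q)"
        using mult_right_mono[of 1 "sqrt 2" "norm (l p - l q)"] by (simp add: rot)
      from order_trans[OF this norm_le_taxi] show ?thesis
        using less_le_trans[OF sep[OF that] mult_left_mono] by simp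
    qed
    show "s * tree_dist n (l p) (l q) \<le> sqrt 26 * norm (p - q) \<or>
       s / sqrt 2 * tree_dist n (h p) (h q) \<le> sqrt 26 * norm (p - q)" if "p \<in> P" "q \<in> P" for p q
      using coupled_stretch[OF cpl[OF that(1)] cpl[OF that(2)], of n n]
    proof
      assume "tree_dist n (l p) (l q) \<le> sqrt 26 * norm (l p - l q)"
      then show ?thesis using mult_left_mono[of _ _ s] s by (fastforce simp: nl algebra_simps)
    next
      assume "tree_dist n (h p) (h q) \<le> sqrt 26 * norm (h p - h q)"
      then have "s / sqrt 2 * tree_dist n (h p) (h q) \<le> s / sqrt 2 * (sqrt 26 * norm (h p - h q))"
        using s by (intro mult_left_mono) auto
      also have "\<dots> = sqrt 26 * norm (p - q)" by (simp add: rot nl)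
      finally show ?thesis by simp
    qed
  qed (use s fl gh in auto)
qed

theorem mainTheorem5:
  fixes P :: "(real^2) set" and n :: nat
  assumes "finite P" and "card P = n" and "n \<ge> 1"
  shows "(\<exists>G. euclidean_spanner (4 * sqrt 26) P G \<and>
              card (undirected_edges G) \<le> 2 * n - 2) \<and>
         (\<exists>G w. steiner_spanner (sqrt 26) P G w \<and>
              card (undirected_edges G) \<le> 4 * n - 4)"
proof
  have P: "P \<noteq> {}" using assms by auto
  obtain l h f g s t N where F:
    "s \<ge> 0" "t \<ge> 0" "l ` P \<subseteq> diamond" "h ` P \<subseteq> diamond"
    "\<And>p. f (l p) = p" "\<And>p. g (h p) = p"
    "\<And>z w. dist (f z) (f w) \<le> s * taxi (z - w)" "\<And>z w. dist (g z) (g w) \<le> t * taxi (z - w)"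
    "\<And>p q. p \<in> P \<Longrightarrow> q \<in> P \<Longrightarrow> p \<noteq> q \<Longrightarrow> 1 < 2 ^ N * taxi (l p - l q)"
    "\<And>p q. p \<in> P \<Longrightarrow> q \<in> P \<Longrightarrow> p \<noteq> q \<Longrightarrow> 1 < 2 ^ N * taxi (h p - h q)"
    and stretch: "\<And>p q. p \<in> P \<Longrightarrow> q \<in> P \<Longrightarrow> s * tree_dist N (l p) (l q) \<le> sqrt 26 * norm (p - q) \<or>
       t * tree_dist N (h p) (h q) \<le> sqrt 26 * norm (p - q)"
    by (rule two_frames[OF assms(1)]; rule that; assumption)
  show "\<exists>G. euclidean_spanner (4 * sqrt 26) P G \<and> card (undirected_edges G) \<le> 2 * n - 2"
  proof -
    have "\<exists>E a b. cell_tree N s l P E a b"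
      by (rule cell_spanner) (use assms P F(1,3,5,9) F(7)[of "l _" "l _"] in auto)
    then obtain E where E: "E \<subseteq> P \<times> P" "card E \<le> n - 1"
      "\<And>p q. p \<in> P \<Longrightarrow> q \<in> P \<Longrightarrow> p \<noteq> q \<Longrightarrow> walk_le E p q (s * (4 * tree_dist N (l p) (l q)))"
      unfolding cell_tree_def assms(2) by blast
    have "\<exists>E a b. cell_tree N t h P E a b"
      by (rule cell_spanner) (use assms P F(2,4,6,10) F(8)[of "h _" "h _"] in auto)
    then obtain D where D: "D \<subseteq> P \<times> P" "card D \<le> n - 1"
      "\<And>p q. p \<in> P \<Longrightarrow> q \<in> P \<Longrightarrow> p \<noteq> q \<Longrightarrow> walk_le D p q (t * (4 * tree_dist N (h p) (h q)))"
      unfolding cell_tree_def assms(2) by blast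
    have fin: "finite (E \<union> D)"
      using E(1) D(1) assms(1) by (meson finite_SigmaI finite_UnI finite_subset)
    let ?G = "edge_graph P (E \<union> D)"
    \<comment> \<open>Each pair uses whichever tree serves it; the factor 4 is that of
      \<open>cell_tree\<close>.\<close>
    have "walk_le (E \<union> D) p q (4 * sqrt 26 * norm (p - q))" if "p \<in> P" "q \<in> P" for p q
    proof (cases "p = q")
      case True
      then show ?thesis by (simp add: walk_le_refl)
    next
      case False
      show ?thesis
        using stretch[OF that] walk_le_mono[OF E(3)[OF that False], of "E \<union> D"]
          walk_le_mono[OF D(3)[OF that False], of "E \<union> D"] by auto
    qed
    then have "euclidean_spanner (4 * sqrt 26) P ?G"
      unfolding euclidean_spanner_def
      using pair_graph_edge_graph[OF assms(1) fin] graph_distance_le[OF assms(1) fin] E(1) D(1)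
      by (auto simp: edge_graph_simps)
    moreover have "card (undirected_edges ?G) \<le> 2 * n - 2"
      using card_undirected_edges_edge_graph[OF fin, of P] card_Un_le[of E D] E(2) D(2) by linarith
    ultimately show ?thesis by blast
  qed
  show "\<exists>G w. steiner_spanner (sqrt 26) P G w \<and> card (undirected_edges G) \<le> 4 * n - 4"
  proof -
    \<comment> \<open>In the outermost cell nothing hangs at the far end, and the edge pending at
      (0, 0) is never built.\<close>
    note steiner = cell_steiner[OF assms(1) finite.emptyI Int_empty_right _ _ _ _ hang_empty,
        unfolded Un_empty_right]
    obtain E where E: "finite E" "card E \<le> 2 * n - 2"
      "\<And>p q. p \<in> P \<Longrightarrow> q \<in> P \<Longrightarrow> p \<noteq> q \<Longrightarrow> walk_le E p q (s * tree_dist N (l p) (l q))"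
      by (rule hangE[OF steiner[of l f s N] P]) (use F assms(2) in auto)
    obtain D where D: "finite D" "card D \<le> 2 * n - 2"
      "\<And>p q. p \<in> P \<Longrightarrow> q \<in> P \<Longrightarrow> p \<noteq> q \<Longrightarrow> walk_le D p q (t * tree_dist N (h p) (h q))"
      by (rule hangE[OF steiner[of h g t N] P]) (use F assms(2) in auto)
    have fin: "finite (E \<union> D)" using E(1) D(1) by simp
    let ?G = "edge_graph P (E \<union> D)"
    note pg = pair_graph_edge_graph[OF assms(1) fin]
    have "walk_le (E \<union> D) p q (sqrt 26 * norm (p - q))" if "p \<in> P" "q \<in> P" for p q
    proof (cases "p = q")
      case True
      then show ?thesis by (simp add: walk_le_refl)
    next
      case False
      show ?thesis
        using stretch[OF that] walk_le_mono[OF E(3)[OF that False], of "E \<union> D"]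
          walk_le_mono[OF D(3)[OF that False], of "E \<union> D"] by auto
    qed
    then have "steiner_spanner (sqrt 26) P ?G euclidean_weight"
      unfolding steiner_spanner_def edge_weighting_def
      using pg graph_distance_le[OF assms(1) fin] norm_le_graph_distance[OF pg]
      by (auto simp: edge_graph_simps euclidean_weight_def norm_minus_commute)
    moreover have "card (undirected_edges ?G) \<le> 4 * n - 4"
      using card_undirected_edges_edge_graph[OF fin, of P] card_Un_le[of E D] E(2) D(2) by linarith
    ultimately show ?thesis by blast
  qed
qed

end
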